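(* There is an absolute constant $C$ such that for every $n\ge1$, every quadratic circuit over $GF(2)$ that computes the product of two $n\times n$ matrices has at least $3n^2 - Cn^{5/3}$ product gates.
   Context: The inputs are two $n\times n$ matrices of variables $x=(x_{i,j})$, $y=(y_{i,j})$, and the $n^2$ outputs are $(x\cdot y)_{i,j}=\sum_{k=1}^n x_{i,k}y_{k,j}$. An arithmetic circuit over a field $F$ is a directed acyclic graph whose in-degree-0 nodes are labeled by input variables, whose edges are labeled by field constants, and whose other nodes are sum gates or product gates; a node computes the sum (resp. product) of the values of its in-neighbours, each multiplied by the constant on the connecting edge. A quadratic circuit is an arithmetic circuit in which every product gate multiplies exactly two linear forms in the input variables (each may involve variables of both $x$ and $y$). *)

theory Defs
  imports
    Complex_Main
    "HOL-Library.Poly_Mapping"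
    "HOL-Library.Z2"
    "Graph_Theory.Digraph"
begin

text \<open>
  Formal multivariate polynomials with variables \<open>'x\<close> and coefficients \<open>'f\<close>: finitely supported
  maps from monomials (exponent vectors) to coefficients. Over GF(2) these must not be confused
  with polynomial functions: \<open>x\<^sup>2\<close> and \<open>x\<close> are different polynomials.
\<close>

type_synonym ('x, 'f) mpoly = "('x \<Rightarrow>\<^sub>0 nat) \<Rightarrow>\<^sub>0 'f"

definition Const :: "'f \<Rightarrow> ('x, 'f::field) mpoly" where
  "Const c = Poly_Mapping.single 0 c"

definition Var :: "'x \<Rightarrow> ('x, 'f::field) mpoly" where
  "Var x = Poly_Mapping.single (Poly_Mapping.single x 1) 1"

definition linear_form :: "'x set \<Rightarrow> ('x, 'f::field) mpoly \<Rightarrow> bool" where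
  "linear_form V p \<longleftrightarrow>
     (\<exists>S c. finite S \<and> S \<subseteq> V \<and> p = (\<Sum>x\<in>S. Const (c x) * Var x))"

datatype 'x node = Input 'x | Sum_Gate | Prod_Gate

text \<open>
  Arcs have their own identity, so parallel arcs are allowed; in particular a product gate may
  take both of its factors from the same node.
\<close>

record ('v, 'a, 'x, 'f) circuit =
  graph :: "('v, 'a) pre_digraph"
  node :: "'v \<Rightarrow> 'x node"
  weight :: "'a \<Rightarrow> 'f"

definition circuit_dag :: "('v, 'a, 'x, 'f) circuit \<Rightarrow> bool" where
  "circuit_dag C \<longleftrightarrow> fin_digraph (graph C) \<and> acyclic (arcs_ends (graph C))"

definition arith_circuit :: "'x set \<Rightarrow> ('v, 'a, 'x, 'f::field) circuit \<Rightarrow> bool" where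
  "arith_circuit V C \<longleftrightarrow>
     circuit_dag C \<and>
     (\<forall>v \<in> verts (graph C). in_degree (graph C) v = 0 \<longrightarrow> (\<exists>x\<in>V. node C v = Input x)) \<and>
     (\<forall>v \<in> verts (graph C). in_degree (graph C) v \<noteq> 0 \<longrightarrow> node C v \<in> {Sum_Gate, Prod_Gate})"

lemma wf_circuit_arcs:
  "wf {((C, u), (C', v)). C' = C \<and> circuit_dag C \<and> (u, v) \<in> arcs_ends (graph C)}"
    (is "wf ?R")
proof (rule wfUNIVI)
  fix P and Cv :: "('a, 'b, 'c, 'd) circuit \<times> 'a"
  assume "\<forall>x. (\<forall>y. (y, x) \<in> ?R \<longrightarrow> P y) \<longrightarrow> P x"
  then have step: "P (C, v)" if "\<And>u. circuit_dag C \<Longrightarrow> (u, v) \<in> arcs_ends (graph C) \<Longrightarrow> P (C, u)"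
    for C v using that by auto
  obtain C v where Cv: "Cv = (C, v)" by (cases Cv)
  have "P (C, v)"
  proof (cases "circuit_dag C")
    case True
    then have "wf (arcs_ends (graph C))"
      by (auto simp: circuit_dag_def arcs_ends_def fin_digraph.finite_arcs
          intro: finite_acyclic_wf)
    then show ?thesis
      by (induction v rule: wf_induct_rule) (rule step)
  next
    case False
    then show ?thesis by (blast intro: step)
  qed
  then show "P Cv" by (simp add: Cv)
qed

text \<open>The guard makes the recursion well-founded; outside of it the value is irrelevant.\<close>

function node_poly :: "('v, 'a, 'x, 'f::field) circuit \<Rightarrow> 'v \<Rightarrow> ('x, 'f) mpoly" where
  "node_poly C v =
     (if circuit_dag C \<and> v \<in> verts (graph C) then
        (case node C v of
           Input x \<Rightarrow> Var x
         | Sum_Gate \<Rightarrow>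
             (\<Sum>e \<in> in_arcs (graph C) v. Const (weight C e) * node_poly C (tail (graph C) e))
         | Prod_Gate \<Rightarrow>
             (\<Prod>e \<in> in_arcs (graph C) v. Const (weight C e) * node_poly C (tail (graph C) e)))
      else 0)"
  by pat_completeness auto

termination
  by (relation "{((C, u), (C', v)). C' = C \<and> circuit_dag C \<and> (u, v) \<in> arcs_ends (graph C)}")
    (rule wf_circuit_arcs, auto simp: arcs_ends_conv in_arcs_def)

declare node_poly.simps [simp del]

definition quadratic_circuit :: "'x set \<Rightarrow> ('v, 'a, 'x, 'f::field) circuit \<Rightarrow> bool" where
  "quadratic_circuit V C \<longleftrightarrow>
     arith_circuit V C \<and>
     (\<forall>v \<in> verts (graph C). node C v = Prod_Gate \<longrightarrow>
        in_degree (graph C) v = 2 \<and>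
        (\<forall>e \<in> in_arcs (graph C) v.
           linear_form V (Const (weight C e) * node_poly C (tail (graph C) e))))"

definition num_prod_gates :: "('v, 'a, 'x, 'f) circuit \<Rightarrow> nat" where
  "num_prod_gates C = card {v \<in> verts (graph C). node C v = Prod_Gate}"

datatype mat_var = X nat nat | Y nat nat

definition mat_vars :: "nat \<Rightarrow> mat_var set" where
  "mat_vars n = {X i j | i j. i \<in> {1..n} \<and> j \<in> {1..n}} \<union> {Y i j | i j. i \<in> {1..n} \<and> j \<in> {1..n}}"

definition mat_prod_entry :: "nat \<Rightarrow> nat \<Rightarrow> nat \<Rightarrow> (mat_var, 'f::field) mpoly" where
  "mat_prod_entry n i j = (\<Sum>k=1..n. Var (X i k) * Var (Y k j))"

definition computes_mat_prod :: "nat \<Rightarrow> ('v, 'a, mat_var, 'f::field) circuit \<Rightarrow> bool" where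
  "computes_mat_prod n C \<longleftrightarrow>
     (\<forall>i \<in> {1..n}. \<forall>j \<in> {1..n}. \<exists>v \<in> verts (graph C). node_poly C v = mat_prod_entry n i j)"

end

theory Submission
  imports Defs "Jordan_Normal_Form.Determinant"
begin

text \<open>
  Evaluated at points of GF(2), each output is an additive form plus a combination of the product
  gates. This gives a linear code: a coefficient matrix \<open>A\<close> is mapped to the coefficients, with
  respect to the gates, of the combination \<open>\<Sum> A\<^sub>i\<^sub>j (x y)\<^sub>i\<^sub>j\<close> of the outputs. The rank of the polarised
  form shows that the codeword of an invertible \<open>A\<close> has weight at least \<open>n\<^sup>2\<close>. The code has dimension
  \<open>n\<^sup>2\<close>; in the coordinates of an information set, the product of the determinants of all nonzero
  combinations of \<open>m\<close> matrices is a nonzero function of degree at most \<open>2\<^sup>m n\<close>, so it has a nonzero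
  at a point with at most \<open>2\<^sup>m n\<close> nonzero coordinates. This is an \<open>m\<close>-dimensional space of matrices,
  invertible except for 0, whose codewords vanish on \<open>n\<^sup>2 - 2\<^sup>m n\<close> gates. By Plotkin's averaging
  argument, the remaining gates number at least \<open>2 (1 - 2\<^sup>-\<^sup>m) n\<^sup>2\<close>. Take \<open>4\<^sup>m \<approx> n\<close>.
\<close>

section \<open>Linear forms over GF(2)\<close>

text \<open>By default, the simplifier turns \<open>+\<close> and \<open>*\<close> on \<open>bit\<close> into \<open>XOR\<close> and \<open>AND\<close>.\<close>

declare add_bit_eq_xor [simp del] mult_bit_eq_and [simp del]

lemma bit_add_self [simp]: "(a :: bit) + a = 0"
  by (cases a) simp_all

lemma bit_add_eq_0_iff [simp]: "(a :: bit) + b = 0 \<longleftrightarrow> a = b"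
  by (cases a; cases b) simp_all

text \<open>Subsets under symmetric difference are the vectors over GF(2). The common part is
  counted twice and cancels, so a sum over a subset is linear in its indicator vector.\<close>

lemma sum_sym_diff_bit:
  fixes f :: "'a \<Rightarrow> bit"
  assumes "finite S" "finite T"
  shows "sum f (sym_diff S T) = sum f S + sum f T"
proof -
  have "sum f S = sum f (S \<inter> T) + sum f (S - T)" "sum f T = sum f (T \<inter> S) + sum f (T - S)"
    using assms by (blast intro: sum.Int_Diff)+
  moreover have "sum f (sym_diff S T) = sum f (S - T) + sum f (T - S)"
    using assms by (intro sum.union_disjoint) auto
  ultimately show ?thesis
    by (cases "sum f (S \<inter> T)") (simp_all add: Int_commute[of T S] algebra_simps)
qed

text \<open>Fewer homogeneous equations than unknowns: by pigeonhole, two different subsets give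
  every form the same value, and their symmetric difference is a nonzero common zero.\<close>

lemma nonempty_subset_common_zero:
  fixes a :: "'d \<Rightarrow> 'u \<Rightarrow> bit"
  assumes "finite U" "finite D" "card D < card U"
  obtains T where "T \<subseteq> U" "T \<noteq> {}" "\<And>d. d \<in> D \<Longrightarrow> (\<Sum>u\<in>T. a d u) = 0"
proof -
  define h where "h T = {d \<in> D. (\<Sum>u\<in>T. a d u) = 1}" for T
  have "h ` Pow U \<subseteq> Pow D"
    by (auto simp: h_def)
  then have "card (h ` Pow U) \<le> card (Pow D)"
    using assms by (intro card_mono) simp_all
  also have "card (Pow D) < card (Pow U)"
    using assms by (simp add: card_Pow)
  finally have "card (h ` Pow U) < card (Pow U)" .
  then have "\<not> inj_on h (Pow U)"
    by (rule pigeonhole)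
  then obtain S T where ST: "S \<subseteq> U" "T \<subseteq> U" "S \<noteq> T" "h S = h T"
    by (auto simp: inj_on_def)
  have fin: "finite S" "finite T"
    using ST(1,2) assms(1) by (blast intro: finite_subset)+
  show ?thesis
  proof
    show "sym_diff S T \<subseteq> U" "sym_diff S T \<noteq> {}"
      using ST by auto
    fix d assume "d \<in> D"
    with ST(4) have "(\<Sum>u\<in>S. a d u) = 1 \<longleftrightarrow> (\<Sum>u\<in>T. a d u) = 1"
      by (auto simp: h_def set_eq_iff)
    then show "(\<Sum>u\<in>sym_diff S T. a d u) = 0"
      by (simp add: sum_sym_diff_bit fin) (metis bit_not_zero_iff)
  qed
qed

text \<open>Each orbit \<open>{x, h x}\<close> has two elements with equal values, which cancel in
  characteristic 2.\<close>

lemma sum_eq_0_if_fixpoint_free_involution: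
  fixes f :: "'a \<Rightarrow> bit"
  assumes "finite A" and "\<And>x. x \<in> A \<Longrightarrow> h x \<in> A" "\<And>x. x \<in> A \<Longrightarrow> h (h x) = x"
    "\<And>x. x \<in> A \<Longrightarrow> h x \<noteq> x" "\<And>x. x \<in> A \<Longrightarrow> f (h x) = f x"
  shows "sum f A = 0"
  using assms
proof (induction "card A" arbitrary: A rule: less_induct)
  case less
  show ?case
  proof (cases "A = {}")
    case False
    then obtain x where x: "x \<in> A" by auto
    let ?B = "A - {x, h x}"
    have "sum f ?B = 0"
    proof (rule less.hyps)
      show "card ?B < card A"
        using x less.prems(1) by (intro psubset_card_mono) auto
      show "h y \<in> ?B" if "y \<in> ?B" for y
      proof -
        have "h y \<noteq> x" "h y \<noteq> h x"
          using that x less.prems(3)[of y] less.prems(3)[of x] by auto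
        then show ?thesis
          using that less.prems(2)[of y] by simp
      qed
    qed (use less.prems in auto)
    moreover have "sum f A = sum f ?B + sum f {x, h x}"
      using x less.prems(1,2) by (intro sum.subset_diff) auto
    moreover have "sum f {x, h x} = 0"
      using x less.prems(4)[OF x] less.prems(5)[OF x] by simp
    ultimately show ?thesis by simp
  qed simp
qed

text \<open>A product of fewer than \<open>card U\<close> linear forms is invariant under a common zero.\<close>

lemma sum_Pow_prod_linear_forms:
  fixes a :: "'d \<Rightarrow> 'u \<Rightarrow> bit"
  assumes "finite U" "finite D" "card D < card U"
  shows "(\<Sum>T\<in>Pow U. \<Prod>d\<in>D. \<Sum>u\<in>T. a d u) = 0"
proof -
  obtain Z where Z: "Z \<subseteq> U" "Z \<noteq> {}" "\<And>d. d \<in> D \<Longrightarrow> (\<Sum>u\<in>Z. a d u) = 0"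
    using nonempty_subset_common_zero[OF assms] by blast
  show ?thesis
  proof (rule sum_eq_0_if_fixpoint_free_involution[where h = "\<lambda>T. sym_diff T Z"])
    fix T assume T: "T \<in> Pow U"
    then have fin: "finite T" "finite Z"
      using Z(1) assms(1) by (auto intro: finite_subset)
    show "(\<Prod>d\<in>D. \<Sum>u\<in>sym_diff T Z. a d u) = (\<Prod>d\<in>D. \<Sum>u\<in>T. a d u)"
      by (intro prod.cong refl) (simp add: sum_sym_diff_bit[OF fin] Z)
  qed (use Z assms(1) in auto)
qed

text \<open>
  For a minimal \<open>T\<close> with \<open>f T \<noteq> 0\<close>, summing \<open>f\<close> over all subsets of \<open>T\<close> leaves only \<open>f T\<close>.
\<close>

lemma sparse_nonzero_point:
  fixes f :: "'u set \<Rightarrow> bit" and a :: "'j \<Rightarrow> 'd \<Rightarrow> 'u \<Rightarrow> bit"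
  assumes "finite U" "finite D"
    and f: "\<And>T. T \<subseteq> U \<Longrightarrow> f T = (\<Sum>j\<in>J. \<Prod>d\<in>D. \<Sum>u\<in>T. a j d u)"
    and ex: "T0 \<subseteq> U" "f T0 \<noteq> 0"
  obtains T where "T \<subseteq> U" "f T \<noteq> 0" "card T \<le> card D"
proof -
  obtain T where T: "T \<subseteq> U" "f T \<noteq> 0" and min: "\<And>S. S \<subseteq> U \<Longrightarrow> f S \<noteq> 0 \<Longrightarrow> card T \<le> card S"
    using ex_has_least_nat[of "\<lambda>T. T \<subseteq> U \<and> f T \<noteq> 0" T0 card] ex by blast
  have finT: "finite T"
    using T(1) assms(1) by (rule finite_subset)
  have "card T \<le> card D"
  proof (rule ccontr)
    assume *: "\<not> card T \<le> card D"
    have "sum f (Pow T) = (\<Sum>S\<in>Pow T. \<Sum>j\<in>J. \<Prod>d\<in>D. \<Sum>u\<in>S. a j d u)"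
      using T(1) by (intro sum.cong f) auto
    also have "\<dots> = (\<Sum>j\<in>J. \<Sum>S\<in>Pow T. \<Prod>d\<in>D. \<Sum>u\<in>S. a j d u)"
      by (rule sum.swap)
    also have "\<dots> = 0"
      using sum_Pow_prod_linear_forms[OF finT assms(2)] * by (intro sum.neutral) auto
    finally have "sum f (Pow T) = 0" .
    moreover have "sum f (Pow T) = f T + sum f (Pow T - {T})"
      using finT by (intro sum.remove) auto
    moreover have "sum f (Pow T - {T}) = 0"
    proof (intro sum.neutral ballI)
      fix S assume "S \<in> Pow T - {T}"
      then have "card S < card T" "S \<subseteq> U"
        using finT T(1) by (auto intro: psubset_card_mono)
      then show "f S = 0"
        using min[of S] by (cases "f S = 0") auto
    qed
    ultimately have "f T = 0"
      by (metis add.right_neutral)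
    with T(2) show False ..
  qed
  with T that show ?thesis by blast
qed

section \<open>Averaging the weights of all subset sums\<close>

lemma card_odd_subset_sums:
  fixes b :: "'a \<Rightarrow> bit"
  assumes "finite M"
  shows "2 * card {E \<in> Pow M. sum b E = 1} \<le> 2 ^ card M"
proof (cases "\<forall>i\<in>M. b i = 0")
  case True
  then have "sum b E = 0" if "E \<subseteq> M" for E
    using that by (intro sum.neutral) auto
  then have "{E \<in> Pow M. sum b E = 1} = {}"
    by force
  then show ?thesis by (simp only:) simp
next
  case False
  \<comment> \<open>Toggling the membership of such an \<open>i\<close> flips the value of the form,
    so the odd subsets inject into the even ones.\<close>
  then obtain i where i: "i \<in> M" "b i = 1" by auto
  let ?O = "{E \<in> Pow M. sum b E = 1}" and ?Z = "{E \<in> Pow M. sum b E = 0}"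
  have "card ?O \<le> card ?Z"
  proof (rule card_inj_on_le[where f = "\<lambda>E. sym_diff E {i}"])
    show "inj_on (\<lambda>E. sym_diff E {i}) ?O"
      by (auto simp: inj_on_def)
    show "(\<lambda>E. sym_diff E {i}) ` ?O \<subseteq> ?Z"
    proof (rule image_subsetI)
      fix E assume E: "E \<in> ?O"
      then have "finite E"
        using assms by (auto intro: finite_subset)
      then have "sum b (sym_diff E {i}) = 0"
        using E i sum_sym_diff_bit[of E "{i}" b] by simp
      then show "sym_diff E {i} \<in> ?Z"
        using E i by auto
    qed
  qed (use assms in simp)
  moreover have "card ?O + card ?Z = card (?O \<union> ?Z)"
    using assms by (intro card_Un_disjoint[symmetric]) auto
  moreover have "?O \<union> ?Z = Pow M"
    by auto
  ultimately show ?thesis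
    using assms by (simp add: card_Pow)
qed

text \<open>Plotkin's double counting: after exchanging the sums, each coordinate \<open>g\<close>
  contributes a linear form in \<open>E\<close>, which is 1 on at most half of the subsets.\<close>

lemma sum_weights_le:
  assumes "finite Q" "finite M"
  shows "2 * (\<Sum>E\<in>Pow M. card {g \<in> Q. (\<Sum>i\<in>E. b g i) = (1 :: bit)}) \<le> card Q * 2 ^ card M"
proof -
  have "(\<Sum>E\<in>Pow M. card {g \<in> Q. (\<Sum>i\<in>E. b g i) = 1}) =
      (\<Sum>E\<in>Pow M. \<Sum>g\<in>Q. if (\<Sum>i\<in>E. b g i) = 1 then 1 else 0)"
    using assms by (simp add: sum.inter_filter[symmetric] cong: if_cong)
  also have "\<dots> = (\<Sum>g\<in>Q. \<Sum>E\<in>Pow M. if (\<Sum>i\<in>E. b g i) = 1 then 1 else 0)"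
    by (rule sum.swap)
  also have "\<dots> = (\<Sum>g\<in>Q. card {E \<in> Pow M. (\<Sum>i\<in>E. b g i) = 1})"
    using assms by (simp add: sum.inter_filter[symmetric] cong: if_cong)
  also have "2 * \<dots> = (\<Sum>g\<in>Q. 2 * card {E \<in> Pow M. (\<Sum>i\<in>E. b g i) = 1})"
    by (rule sum_distrib_left)
  also have "\<dots> \<le> (\<Sum>g\<in>Q. 2 ^ card M)"
    using assms by (intro sum_mono card_odd_subset_sums)
  finally show ?thesis by simp
qed

section \<open>Determinants and spaces of invertible matrices\<close>

lemma det_mat_neq_0_iff:
  fixes A :: "nat \<Rightarrow> nat \<Rightarrow> 'a :: field"
  shows "det (mat n n (\<lambda>(i, j). A i j)) \<noteq> 0 \<longleftrightarrow>
    (\<forall>v. (\<forall>i<n. (\<Sum>j<n. A i j * v j) = 0) \<longrightarrow> (\<forall>j<n. v j = 0))"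
    (is "det ?A \<noteq> 0 \<longleftrightarrow> ?R")
proof -
  have A: "?A \<in> carrier_mat n n" by simp
  have mult: "?A *\<^sub>v vec n v = 0\<^sub>v n \<longleftrightarrow> (\<forall>i<n. (\<Sum>j<n. A i j * v j) = 0)" for v
    by (auto simp: vec_eq_iff scalar_prod_def lessThan_atLeast0 intro!: sum.cong
        cong: sum.cong_simp)
  have zero: "vec n v = 0\<^sub>v n \<longleftrightarrow> (\<forall>j<n. v j = 0)" for v :: "nat \<Rightarrow> 'a"
    by (auto simp: vec_eq_iff)
  have "det ?A \<noteq> 0 \<longleftrightarrow> (\<forall>w\<in>carrier_vec n. ?A *\<^sub>v w = 0\<^sub>v n \<longrightarrow> w = 0\<^sub>v n)"
    by (auto simp: det_0_iff_vec_prod_zero_field[OF A])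
  also have "\<dots> \<longleftrightarrow> (\<forall>v. ?A *\<^sub>v vec n v = 0\<^sub>v n \<longrightarrow> vec n v = 0\<^sub>v n)"
  proof -
    have "w \<in> carrier_vec n \<longleftrightarrow> (\<exists>v. w = vec n v)" for w :: "'a vec"
    proof
      assume "w \<in> carrier_vec n"
      then have "w = vec n (($) w)"
        by (intro eq_vecI) auto
      then show "\<exists>v. w = vec n v"
        by blast
    qed auto
    then show ?thesis by (auto simp: Ball_def)
  qed
  finally show ?thesis
    by (simp only: mult zero)
qed

lemma kernel_trivial_if_det_neq_0:
  fixes A :: "nat \<Rightarrow> nat \<Rightarrow> 'a :: field"
  assumes "det (mat n n (\<lambda>(i, j). A i j)) \<noteq> 0"
    and "\<And>i. i < n \<Longrightarrow> (\<Sum>j<n. A i j * v j) = 0" and "j < n"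
  shows "v j = 0"
  using assms unfolding det_mat_neq_0_iff by blast

lemma left_kernel_trivial_if_det_neq_0:
  fixes A :: "nat \<Rightarrow> nat \<Rightarrow> 'a :: field"
  assumes "det (mat n n (\<lambda>(i, j). A i j)) \<noteq> 0"
    and "\<And>j. j < n \<Longrightarrow> (\<Sum>i<n. A i j * v i) = 0" and "i < n"
  shows "v i = 0"
proof (rule kernel_trivial_if_det_neq_0)
  have "transpose_mat (mat n n (\<lambda>(i, j). A i j)) = mat n n (\<lambda>(i, j). A j i)"
    by (intro eq_matI) auto
  then show "det (mat n n (\<lambda>(i, j). A j i)) \<noteq> 0"
    using assms(1) det_transpose[of "mat n n (\<lambda>(i, j). A i j)" n] by simp
qed (use assms in auto)

text \<open>Leibniz expansion with one permutation chosen for each \<open>E\<close>. It has the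
  shape required by \<open>sparse_nonzero_point\<close>, with \<open>card Es * n\<close> linear
  factors in each product.\<close>

lemma prod_det_as_sum_of_products:
  fixes a :: "'e \<Rightarrow> nat \<Rightarrow> nat \<Rightarrow> 'u \<Rightarrow> bit"
  assumes "finite Es"
  shows "(\<Prod>E\<in>Es. det (mat n n (\<lambda>(r, s). \<Sum>u\<in>T. a E r s u))) =
    (\<Sum>\<pi>\<in>Es \<rightarrow>\<^sub>E {p. p permutes {0..<n}}.
       \<Prod>d\<in>Es \<times> {0..<n}. \<Sum>u\<in>T. a (fst d) (snd d) (\<pi> (fst d) (snd d)) u)"
proof -
  let ?P = "{p. p permutes {0..<n}}"
  have det: "det (mat n n (\<lambda>(r, s). M r s)) = (\<Sum>p\<in>?P. \<Prod>r=0..<n. M r (p r))"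
    for M :: "nat \<Rightarrow> nat \<Rightarrow> bit"
  proof -
    have "det (mat n n (\<lambda>(r, s). M r s)) =
        (\<Sum>p\<in>?P. signof p * (\<Prod>r=0..<n. mat n n (\<lambda>(r, s). M r s) $$ (r, p r)))"
      by (rule det_def') simp
    also have "\<dots> = (\<Sum>p\<in>?P. \<Prod>r=0..<n. M r (p r))"
    proof (rule sum.cong[OF refl])
      fix p assume p: "p \<in> ?P"
      have "(\<Prod>r=0..<n. mat n n (\<lambda>(r, s). M r s) $$ (r, p r)) = (\<Prod>r=0..<n. M r (p r))"
        using p by (intro prod.cong) (auto simp: permutes_in_image[of p "{0..<n}", simplified])
      \<comment> \<open>The sign disappears because -1 = 1 in GF(2).\<close>
      then show "signof p * (\<Prod>r=0..<n. mat n n (\<lambda>(r, s). M r s) $$ (r, p r)) =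
          (\<Prod>r=0..<n. M r (p r))"
        by (simp add: sign_def)
    qed
    finally show ?thesis .
  qed
  have "(\<Prod>E\<in>Es. det (mat n n (\<lambda>(r, s). \<Sum>u\<in>T. a E r s u))) =
      (\<Prod>E\<in>Es. \<Sum>p\<in>?P. \<Prod>r=0..<n. \<Sum>u\<in>T. a E r (p r) u)"
    by (simp only: det)
  also have "\<dots> = (\<Sum>\<pi>\<in>Es \<rightarrow>\<^sub>E ?P. \<Prod>E\<in>Es. \<Prod>r=0..<n. \<Sum>u\<in>T. a E r (\<pi> E r) u)"
    using assms by (intro prod_sum_PiE) (auto simp: finite_permutations)
  finally show ?thesis
    by (simp add: prod.cartesian_product case_prod_unfold)
qed

text \<open>
  Multiplication by a nonzero \<open>p\<close> of degree less than \<open>m\<close> is injective modulo \<open>g = 1 + x\<^sup>k h\<close> if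
  \<open>h\<close> is the product of all these \<open>p\<close>: they are units modulo \<open>g\<close>. So no irreducible polynomial of
  degree \<open>n\<close> is needed.
\<close>

lemma exists_linear_space_of_invertible_matrices:
  assumes "4 ^ m \<le> n"
  shows "\<exists>B :: nat \<Rightarrow> nat \<Rightarrow> nat \<Rightarrow> bit. \<forall>E. E \<subseteq> {..<m} \<longrightarrow> E \<noteq> {} \<longrightarrow>
    det (mat n n (\<lambda>(r, s). \<Sum>i\<in>E. B i r s)) \<noteq> 0"
proof -
  define p where "p E = (\<Sum>i\<in>E. monom 1 i :: bit poly)" for E
  define Es where "Es = Pow {..<m} - {{}}"
  define h where "h = (\<Prod>E\<in>Es. p E)"
  \<comment> \<open>The exponent is chosen so that \<open>g\<close> has degree
    \<open>n\<close>.\<close>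
  define g where "g = 1 + monom 1 (n - degree h) * h"
  \<comment> \<open>\<open>B i\<close> is the matrix of multiplication by x^i modulo
    \<open>g\<close> in the basis 1, x, ..., x^(n-1), so the sum over \<open>E\<close> is the matrix
    of multiplication by \<open>p E\<close>.\<close>
  define B where "B i r s = coeff (monom 1 (i + s) mod g) r" for i r s
  have finE: "finite E" if "E \<subseteq> {..<m}" for E
    using that by (rule finite_subset) simp
  have coeff_p: "coeff (p E) i = (if i \<in> E then 1 else 0)" if "E \<subseteq> {..<m}" for E i
    using finE[OF that] by (simp add: p_def coeff_sum)
  have p_nz: "p E \<noteq> 0" if "E \<in> Es" for E
  proof -
    obtain i where "i \<in> E" "E \<subseteq> {..<m}"
      using \<open>E \<in> Es\<close> by (auto simp: Es_def)
    then have "coeff (p E) i \<noteq> 0"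
      by (simp add: coeff_p)
    then show ?thesis by auto
  qed
  \<comment> \<open>With m < 2^m this leads to degree h <= 2^m * m <= 4^m <= n, so the subtraction
    in the exponent of \<open>g\<close> is not truncated.\<close>
  have "degree (p E) \<le> m" if "E \<in> Es" for E
    using that by (intro degree_le) (auto simp: Es_def coeff_p subset_iff)
  then have "(\<Sum>E\<in>Es. degree (p E)) \<le> card Es * m"
    using sum_bounded_above[of Es "\<lambda>E. degree (p E)" m] by simp
  moreover have "degree h = (\<Sum>E\<in>Es. degree (p E))"
    unfolding h_def using p_nz by (intro degree_prod_eq_sum_degree) auto
  moreover have "card Es \<le> 2 ^ m"
    by (simp add: Es_def card_Pow)
  then have "card Es * m \<le> 2 ^ m * 2 ^ m"
    by (intro mult_le_mono) (simp_all add: less_imp_le)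
  moreover have "(2::nat) ^ m * 2 ^ m = 4 ^ m"
    by (simp flip: power_mult_distrib)
  ultimately have deg_h: "degree h \<le> n"
    using assms by linarith
  have h_nz: "h \<noteq> 0"
    using p_nz by (simp add: h_def Es_def)
  have n_pos: "n > 0"
    using assms by (cases n) auto
  have "degree (monom 1 (n - degree h) * h) = n"
    using h_nz deg_h by (simp add: degree_mult_eq degree_monom_eq monom_eq_0_iff)
  then have deg_g: "degree g = n"
    unfolding g_def using n_pos by (subst degree_add_eq_right) simp_all
  then have g_nz: "g \<noteq> 0"
    using n_pos by auto
  have mod_sum: "sum f S mod g = (\<Sum>x\<in>S. f x mod g)" for f :: "nat \<Rightarrow> bit poly" and S
    by (induction S rule: infinite_finite_induct) (simp_all add: poly_mod_add_left)
  show ?thesis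
  proof (intro exI[of _ B] allI impI)
    fix E assume E: "E \<subseteq> {..<m}" "E \<noteq> {}"
    show "det (mat n n (\<lambda>(r, s). \<Sum>i\<in>E. B i r s)) \<noteq> 0"
      unfolding det_mat_neq_0_iff
    proof (intro allI impI)
      fix v :: "nat \<Rightarrow> bit" and s
      assume v: "\<forall>r<n. (\<Sum>s<n. (\<Sum>i\<in>E. B i r s) * v s) = 0" and s: "s < n"
      \<comment> \<open>The kernel vector, read as a polynomial of degree less than
        \<open>n\<close>; the kernel equations say that \<open>g\<close> divides
        \<open>p E * q\<close>.\<close>
      define q where "q = (\<Sum>s<n. monom (v s) s)"
      have coeff_q: "coeff q s = (if s < n then v s else 0)" for s
        by (simp add: q_def coeff_sum)
      have "p E * q = (\<Sum>s<n. \<Sum>i\<in>E. smult (v s) (monom 1 (i + s)))"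
        by (simp add: p_def q_def sum_product mult_monom smult_monom) (rule sum.swap)
      then have "(p E * q) mod g = (\<Sum>s<n. \<Sum>i\<in>E. smult (v s) (monom 1 (i + s) mod g))"
        by (simp only: mod_sum mod_smult_left)
      then have "coeff ((p E * q) mod g) r = (\<Sum>s<n. (\<Sum>i\<in>E. B i r s) * v s)" for r
        by (simp add: coeff_sum B_def sum_distrib_left mult.commute)
      then have "coeff ((p E * q) mod g) r = 0" if "r < n" for r
        using v that by simp
      moreover have "coeff ((p E * q) mod g) r = 0" if "r \<ge> n" for r
        using degree_mod_less[OF g_nz, of "p E * q"] that
        by (metis coeff_0 coeff_eq_0 deg_g less_le_trans)
      ultimately have "(p E * q) mod g = 0"
        by (metis coeff_0 leI poly_eqI)
      then have "g dvd p E * q"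
        by (simp add: mod_eq_0_iff_dvd)
      moreover have "p E dvd h"
        unfolding h_def using E by (intro dvd_prodI) (auto simp: Es_def)
      then obtain h' where "h = p E * h'" ..
      \<comment> \<open>The Bezout identity for \<open>g\<close> and \<open>p E\<close>, multiplied
        by \<open>q\<close>; both terms on the right are multiples of \<open>g\<close>.\<close>
      then have "q = g * q - monom 1 (n - degree h) * h' * (p E * q)"
        by (simp add: g_def algebra_simps)
      ultimately have "g dvd q"
        by (metis dvd_diff dvd_mult dvd_triv_left)
      moreover have "degree q < n"
        using n_pos by (intro degree_lessI) (auto simp: coeff_q)
      ultimately have "q = 0"
        using deg_g dvd_imp_degree_le leD by blast
      then show "v s = 0"
        using coeff_q[of s] s by simp
    qed
  qed
qed

section \<open>The code of a quadratic computation\<close>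

definition unit_point :: "'x \<Rightarrow> 'x \<Rightarrow> bit" where
  "unit_point x y = (if y = x then 1 else 0)"

text \<open>Over GF(2) the only scalars are 0 and 1, so additivity alone is linearity.\<close>

definition additive_form :: "(('x \<Rightarrow> bit) \<Rightarrow> bit) \<Rightarrow> bool" where
  "additive_form f \<longleftrightarrow> (\<forall>\<sigma> \<tau>. f (\<lambda>x. \<sigma> x + \<tau> x) = f \<sigma> + f \<tau>)"

lemma additive_formD: "additive_form f \<Longrightarrow> f (\<lambda>x. \<sigma> x + \<tau> x) = f \<sigma> + f \<tau>"
  by (simp add: additive_form_def)

text \<open>There may be infinitely many variables, so the unit points control the form only at
  points of finite support.\<close>

lemma additive_form_indicator:
  assumes f: "additive_form f" and "finite T"
  shows "f (\<lambda>x. if x \<in> T then 1 else 0) = (\<Sum>u\<in>T. f (unit_point u))"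
  using assms(2)
proof (induction T)
  case empty
  have "f (\<lambda>_. 0) = f (\<lambda>_. 0) + f (\<lambda>_. 0)"
    using additive_formD[OF f, of "\<lambda>_. 0" "\<lambda>_. 0"] by simp
  then show ?case by simp
next
  case (insert u T)
  have "(\<lambda>x. if x \<in> insert u T then 1 else 0) =
      (\<lambda>x. unit_point u x + (if x \<in> T then 1 else 0))"
    using insert.hyps by (auto simp: unit_point_def fun_eq_iff)
  then show ?case
    using insert by (simp add: additive_formD[OF f])
qed

text \<open>What is kept of a circuit: \<open>l g\<close> and \<open>r g\<close> are the factors of
  gate \<open>g\<close>, and each output is a combination of their products plus an additive part.
  Indices start at 0 here and at 1 in the variables, hence the \<open>Suc\<close>.\<close>

locale quadratic_mat_prod =
  fixes n :: nat and P :: "'g set" and l r :: "'g \<Rightarrow> (mat_var \<Rightarrow> bit) \<Rightarrow> bit"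
    and \<gamma> :: "nat \<Rightarrow> nat \<Rightarrow> 'g \<Rightarrow> bit" and L :: "nat \<Rightarrow> nat \<Rightarrow> (mat_var \<Rightarrow> bit) \<Rightarrow> bit"
  assumes finite_P: "finite P"
    and additive_l: "g \<in> P \<Longrightarrow> additive_form (l g)"
    and additive_r: "g \<in> P \<Longrightarrow> additive_form (r g)"
    and additive_L: "i < n \<Longrightarrow> j < n \<Longrightarrow> additive_form (L i j)"
    and output_eq: "i < n \<Longrightarrow> j < n \<Longrightarrow>
      (\<Sum>k<n. \<sigma> (X (Suc i) (Suc k)) * \<sigma> (Y (Suc k) (Suc j))) =
        L i j \<sigma> + (\<Sum>g\<in>P. \<gamma> i j g * (l g \<sigma> * r g \<sigma>))"
begin

text \<open>
  \<open>code A\<close> is the vector of coefficients, with respect to the product gates, of the linear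
  combination of the outputs given by \<open>A\<close>.
\<close>

definition code :: "(nat \<Rightarrow> nat \<Rightarrow> bit) \<Rightarrow> 'g \<Rightarrow> bit" where
  "code A g = (\<Sum>i<n. \<Sum>j<n. A i j * \<gamma> i j g)"

lemma code_add: "code (\<lambda>i j. A i j + B i j) g = code A g + code B g"
  by (simp add: code_def algebra_simps sum.distrib)

lemma code_sum: "code (\<lambda>i j. \<Sum>x\<in>S. F x i j) g = (\<Sum>x\<in>S. code (F x) g)"
proof -
  have "code (\<lambda>i j. \<Sum>x\<in>S. F x i j) g = (\<Sum>i<n. \<Sum>x\<in>S. \<Sum>j<n. F x i j * \<gamma> i j g)"
    unfolding code_def by (simp add: sum_distrib_right) (intro sum.cong refl sum.swap)
  also have "\<dots> = (\<Sum>x\<in>S. code (F x) g)"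
    unfolding code_def by (rule sum.swap)
  finally show ?thesis .
qed

lemma code_cmult: "code (\<lambda>i j. c * A i j) g = c * code A g"
  by (simp add: code_def sum_distrib_left mult.assoc)

lemma code_if: "code (\<lambda>i j. if c then A i j else 0) g = (if c then code A g else 0)"
  by (simp add: code_def)

section \<open>Polarisation of the computation\<close>

lemma polarised_output_eq:
  assumes "i < n" "j < n"
  shows "(\<Sum>k<n. \<sigma> (X (Suc i) (Suc k)) * \<tau> (Y (Suc k) (Suc j)) +
                 \<tau> (X (Suc i) (Suc k)) * \<sigma> (Y (Suc k) (Suc j))) =
    (\<Sum>g\<in>P. \<gamma> i j g * (l g \<sigma> * r g \<tau> + l g \<tau> * r g \<sigma>))" (is "?lhs = ?rhs")
proof -
  define q where "q \<sigma> = (\<Sum>k<n. \<sigma> (X (Suc i) (Suc k)) * \<sigma> (Y (Suc k) (Suc j)))"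
    for \<sigma> :: "mat_var \<Rightarrow> bit"
  define s where "s \<sigma> = (\<Sum>g\<in>P. \<gamma> i j g * (l g \<sigma> * r g \<sigma>))" for \<sigma>
  let ?\<rho> = "\<lambda>x. \<sigma> x + \<tau> x"
  have q: "q \<rho> = L i j \<rho> + s \<rho>" for \<rho>
    using output_eq[OF assms] by (simp add: q_def s_def)
  \<comment> \<open>The polar form \<open>q ?\<rho> + q \<sigma> + q \<tau>\<close> is computed in
    two ways; the additive part \<open>L i j\<close> contributes nothing to it.\<close>
  have "q ?\<rho> = q \<sigma> + q \<tau> + ?lhs"
    by (simp add: q_def algebra_simps sum.distrib)
  moreover have "s ?\<rho> = s \<sigma> + s \<tau> + ?rhs"
    by (simp add: s_def algebra_simps flip: sum.distrib)
      (intro sum.cong refl,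
       simp add: additive_formD[OF additive_l] additive_formD[OF additive_r] algebra_simps)
  ultimately have "L i j \<sigma> + L i j \<tau> + (s \<sigma> + s \<tau> + ?rhs) = (L i j \<sigma> + s \<sigma>) + (L i j \<tau> + s \<tau>) + ?lhs"
    using q[of ?\<rho>] q[of \<sigma>] q[of \<tau>] additive_formD[OF additive_L[OF assms], of \<sigma> \<tau>] by simp
  then have "L i j \<sigma> + L i j \<tau> + s \<sigma> + s \<tau> + ?rhs = L i j \<sigma> + L i j \<tau> + s \<sigma> + s \<tau> + ?lhs"
    by (simp only: ac_simps)
  then show ?thesis
    by (simp only: add_left_cancel)
qed

lemma polarised_code_eq:
  "(\<Sum>i<n. \<Sum>j<n. A i j * (\<Sum>k<n. \<sigma> (X (Suc i) (Suc k)) * \<tau> (Y (Suc k) (Suc j)) +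
                               \<tau> (X (Suc i) (Suc k)) * \<sigma> (Y (Suc k) (Suc j)))) =
    (\<Sum>g\<in>P. code A g * (l g \<sigma> * r g \<tau> + l g \<tau> * r g \<sigma>))" (is "?lhs = _")
proof -
  let ?h = "\<lambda>g. l g \<sigma> * r g \<tau> + l g \<tau> * r g \<sigma>"
  have "?lhs = (\<Sum>i<n. \<Sum>j<n. \<Sum>g\<in>P. A i j * \<gamma> i j g * ?h g)"
    by (intro sum.cong refl) (simp add: polarised_output_eq sum_distrib_left mult.assoc)
  also have "\<dots> = (\<Sum>i<n. \<Sum>g\<in>P. \<Sum>j<n. A i j * \<gamma> i j g * ?h g)"
    by (intro sum.cong refl sum.swap)
  also have "\<dots> = (\<Sum>g\<in>P. \<Sum>i<n. \<Sum>j<n. A i j * \<gamma> i j g * ?h g)"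
    by (rule sum.swap)
  finally show ?thesis
    by (simp add: code_def sum_distrib_right)
qed

text \<open>Taking \<tau> to be the unit point of a \<open>Y\<close> variable isolates one entry of
  the product of the transpose of \<open>A\<close> with the \<open>X\<close> part of \<sigma>. A
  \<sigma> in the radical thus satisfies kernel equations for \<open>A\<close>.\<close>

lemma polarised_at_Y:
  assumes "k < n" "j < n"
  shows "(\<Sum>i<n. A i j * \<sigma> (X (Suc i) (Suc k))) =
    (\<Sum>g\<in>P. code A g * (l g \<sigma> * r g (unit_point (Y (Suc k) (Suc j)))
                         + l g (unit_point (Y (Suc k) (Suc j))) * r g \<sigma>))"
proof -
  have "(\<Sum>k'<n. \<sigma> (X (Suc i) (Suc k')) * unit_point (Y (Suc k) (Suc j)) (Y (Suc k') (Suc j')) +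
          unit_point (Y (Suc k) (Suc j)) (X (Suc i) (Suc k')) * \<sigma> (Y (Suc k') (Suc j'))) =
      (if j' = j then \<sigma> (X (Suc i) (Suc k)) else 0)" for i j'
    using assms by (simp add: unit_point_def if_distrib[of "\<lambda>x. _ * x"] cong: if_cong)
  then show ?thesis
    using assms by (simp add: if_distrib[of "\<lambda>x. _ * x"] cong: if_cong flip: polarised_code_eq)
qed

lemma polarised_at_X:
  assumes "i < n" "k < n"
  shows "(\<Sum>j<n. A i j * \<sigma> (Y (Suc k) (Suc j))) =
    (\<Sum>g\<in>P. code A g * (l g \<sigma> * r g (unit_point (X (Suc i) (Suc k)))
                         + l g (unit_point (X (Suc i) (Suc k))) * r g \<sigma>))"
proof -
  have "(\<Sum>k'<n. \<sigma> (X (Suc i') (Suc k')) * unit_point (X (Suc i) (Suc k)) (Y (Suc k') (Suc j)) +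
          unit_point (X (Suc i) (Suc k)) (X (Suc i') (Suc k')) * \<sigma> (Y (Suc k') (Suc j))) =
      (if i' = i then \<sigma> (Y (Suc k) (Suc j)) else 0)" for i' j
    using assms by (simp add: unit_point_def if_distrib[of "\<lambda>x. x * _"] cong: if_cong)
  then have "(\<Sum>g\<in>P. code A g * (l g \<sigma> * r g (unit_point (X (Suc i) (Suc k)))
                         + l g (unit_point (X (Suc i) (Suc k))) * r g \<sigma>)) =
      (\<Sum>i'<n. if i' = i then \<Sum>j<n. A i' j * \<sigma> (Y (Suc k) (Suc j)) else 0)"
    by (simp only: flip: polarised_code_eq) (intro sum.cong refl, simp)
  then show ?thesis
    using assms by simp
qed

text \<open>Injectivity of the code: the polarised form at the unit points of
  \<open>X (Suc i) (Suc 0)\<close> and \<open>Y (Suc 0) (Suc j)\<close> has the value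
  \<open>A i j\<close>.\<close>

lemma eq_0_if_code_eq_0:
  assumes "\<And>g. g \<in> P \<Longrightarrow> code A g = 0" and "i < n" "j < n"
  shows "A i j = 0"
proof -
  have "(\<Sum>i'<n. A i' j * unit_point (X (Suc i) (Suc 0)) (X (Suc i') (Suc 0))) = 0"
    using assms by (subst polarised_at_Y) auto
  then show ?thesis
    using assms by (simp add: unit_point_def if_distrib[of "\<lambda>x. _ * x"] cong: if_cong)
qed

text \<open>
  With fewer than \<open>n\<^sup>2\<close> active gates, their factors have a common nonzero zero \<open>\<sigma>\<close>, which lies in the
  radical of the polarised form; that form is nondegenerate when \<open>A\<close> is invertible.
\<close>

lemma weight_code_ge:
  assumes det: "det (mat n n (\<lambda>(i, j). A i j)) \<noteq> 0"
  shows "n * n \<le> card {g \<in> P. code A g = 1}"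
proof (rule ccontr)
  define Q where "Q = {g \<in> P. code A g = 1}"
  define N where "N = {..<n} \<times> {..<n}"
  define x where "x = (\<lambda>(i, k). X (Suc i) (Suc k))"
  define y where "y = (\<lambda>(i, k). Y (Suc i) (Suc k))"
  \<comment> \<open>The boolean selects the factor: each active gate imposes two linear conditions
    on the 2 n^2 variables.\<close>
  define a where "a d = (\<lambda>u. (if snd d then l else r) (fst d) (unit_point u))" for d
  assume "\<not> n * n \<le> card {g \<in> P. code A g = 1}"
  then have "card Q < n * n"
    by (simp add: Q_def)
  then have "card (Q \<times> (UNIV :: bool set)) < 2 * (n * n)"
    by (simp add: card_cartesian_product)
  moreover have "card (x ` N \<union> y ` N) = card (x ` N) + card (y ` N)"
    by (intro card_Un_disjoint) (auto simp: N_def x_def y_def)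
  moreover have "card (x ` N) = n * n" "card (y ` N) = n * n"
    by (subst card_image; auto simp: N_def x_def y_def inj_on_def)+
  ultimately have "card (Q \<times> (UNIV :: bool set)) < card (x ` N \<union> y ` N)"
    by simp
  moreover have "finite (x ` N \<union> y ` N)" "finite (Q \<times> (UNIV :: bool set))"
    using finite_P by (simp_all add: N_def Q_def)
  ultimately obtain T where T: "T \<subseteq> x ` N \<union> y ` N" "T \<noteq> {}"
      "\<And>d. d \<in> Q \<times> UNIV \<Longrightarrow> (\<Sum>u\<in>T. a d u) = 0"
    using nonempty_subset_common_zero[of "x ` N \<union> y ` N" "Q \<times> UNIV" a] by blast
  define \<sigma> where "\<sigma> u = (if u \<in> T then 1 else 0 :: bit)" for u
  have finT: "finite T"
    using T(1) by (rule finite_subset) (simp add: N_def)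
  have lr: "l g \<sigma> = 0" "r g \<sigma> = 0" if "g \<in> Q" for g
    using that T(3)[of "(g, True)"] T(3)[of "(g, False)"]
      additive_form_indicator[OF additive_l finT] additive_form_indicator[OF additive_r finT]
    by (simp_all add: Q_def a_def \<sigma>_def[abs_def])
  have zero: "code A g * (l g \<sigma> * b + c * r g \<sigma>) = 0" if "g \<in> P" for g b c
    using that lr[of g] by (cases "code A g = 1") (auto simp: Q_def)
  have "\<sigma> (X (Suc i) (Suc k)) = 0" if "i < n" "k < n" for i k
  proof (rule left_kernel_trivial_if_det_neq_0[OF det _ \<open>i < n\<close>])
    show "(\<Sum>i<n. A i j * \<sigma> (X (Suc i) (Suc k))) = 0" if "j < n" for j
      using that \<open>k < n\<close> by (simp add: polarised_at_Y zero)
  qed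
  moreover have "\<sigma> (Y (Suc k) (Suc j)) = 0" if "k < n" "j < n" for k j
  proof (rule kernel_trivial_if_det_neq_0[OF det _ \<open>j < n\<close>])
    show "(\<Sum>j<n. A i j * \<sigma> (Y (Suc k) (Suc j))) = 0" if "i < n" for i
      using that \<open>k < n\<close> by (simp add: polarised_at_X zero)
  qed
  ultimately have "\<sigma> u = 0" if "u \<in> x ` N \<union> y ` N" for u
    using that by (auto simp: N_def x_def y_def)
  moreover obtain u where "u \<in> T"
    using T(2) by blast
  moreover have "\<sigma> u = 1"
    using \<open>u \<in> T\<close> by (simp add: \<sigma>_def)
  ultimately show False
    using T(1) by (metis subsetD zero_neq_one)
qed

text \<open>
  A minimal set \<open>K\<close> of gates that determines \<open>A\<close> from \<open>code A\<close>; minimality yields the dual basis \<open>D\<close>.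
\<close>

lemma information_set:
  obtains K D where "K \<subseteq> P" "n * n \<le> card K"
    "\<And>k g. k \<in> K \<Longrightarrow> g \<in> K \<Longrightarrow> code (D k) g = (if g = k then 1 else 0)"
    "\<And>A i j. i < n \<Longrightarrow> j < n \<Longrightarrow> A i j = (\<Sum>k\<in>K. code A k * D k i j)"
proof -
  define determining where
    "determining K \<longleftrightarrow> (\<forall>A. (\<forall>g\<in>K. code A g = 0) \<longrightarrow> (\<forall>i<n. \<forall>j<n. A i j = 0))" for K
  have "determining P"
    using eq_0_if_code_eq_0 by (auto simp: determining_def)
  then obtain K where K: "K \<subseteq> P" "determining K"
    and min: "\<And>K'. K' \<subseteq> P \<Longrightarrow> determining K' \<Longrightarrow> card K \<le> card K'"
    using ex_has_least_nat[of "\<lambda>K. K \<subseteq> P \<and> determining K" P card] by blast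
  have finK: "finite K"
    using K(1) finite_P by (rule finite_subset)
  have "\<exists>A. \<forall>g\<in>K. code A g = (if g = k then 1 else 0)" if k: "k \<in> K" for k
  proof -
    have "card (K - {k}) < card K"
      using k finK by (intro psubset_card_mono) auto
    then have "\<not> determining (K - {k})"
      using min[of "K - {k}"] K(1) by auto
    then obtain A i j where A: "\<forall>g\<in>K - {k}. code A g = 0" "i < n" "j < n" "A i j \<noteq> 0"
      unfolding determining_def by blast
    then have "\<not> (\<forall>g\<in>K. code A g = 0)"
      using K(2) unfolding determining_def by blast
    then have "code A k \<noteq> 0"
      using A(1) by blast
    then have "\<forall>g\<in>K. code A g = (if g = k then 1 else 0)"
      using A(1) by auto
    then show ?thesis by blast
  qed
  then obtain D where D: "\<And>k g. k \<in> K \<Longrightarrow> g \<in> K \<Longrightarrow> code (D k) g = (if g = k then 1 else 0)"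
    by metis
  \<comment> \<open>Otherwise the code restricted to \<open>K\<close>, a linear map from n^2 entries
    to fewer gates, has a nonzero matrix in its kernel.\<close>
  have "n * n \<le> card K"
  proof (rule ccontr)
    let ?N = "{..<n} \<times> {..<n}"
    assume "\<not> n * n \<le> card K"
    then have "card K < card ?N"
      by simp
    then obtain T where T: "T \<subseteq> ?N" "T \<noteq> {}" "\<And>g. g \<in> K \<Longrightarrow> (\<Sum>u\<in>T. \<gamma> (fst u) (snd u) g) = 0"
      using nonempty_subset_common_zero[of ?N K "\<lambda>g u. \<gamma> (fst u) (snd u) g"] finK by auto
    define A where "A i j = (if (i, j) \<in> T then 1 else 0 :: bit)" for i j
    have "code A g = 0" if "g \<in> K" for g
    proof -
      have "code A g = (\<Sum>u\<in>?N. if u \<in> T then \<gamma> (fst u) (snd u) g else 0)"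
        unfolding code_def A_def
        by (simp add: sum.cartesian_product case_prod_unfold) (intro sum.cong refl, auto)
      also have "\<dots> = (\<Sum>u\<in>T. \<gamma> (fst u) (snd u) g)"
        using T(1) by (simp add: sum.inter_restrict[symmetric] Int_absorb1)
      finally show ?thesis
        using T(3) that by simp
    qed
    then have zero: "A i j = 0" if "i < n" "j < n" for i j
      using K(2) that unfolding determining_def by blast
    obtain i j where "(i, j) \<in> T" "i < n" "j < n"
      using T(1,2) by auto
    then show False
      using zero[of i j] by (simp add: A_def)
  qed
  moreover have "A i j = (\<Sum>k\<in>K. code A k * D k i j)" if ij: "i < n" "j < n" for A i j
  proof -
    \<comment> \<open>In characteristic 2 this is the difference between \<open>A\<close> and its
      expansion; its code vanishes on \<open>K\<close>.\<close>
    let ?B = "\<lambda>i j. A i j + (\<Sum>k\<in>K. code A k * D k i j)"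
    have "code ?B g = 0" if g: "g \<in> K" for g
    proof -
      have "(\<Sum>k\<in>K. code A k * code (D k) g) = (\<Sum>k\<in>K. if k = g then code A k else 0)"
        using g by (intro sum.cong refl) (auto simp: D)
      also have "\<dots> = code A g"
        using g finK by simp
      finally show ?thesis
        by (simp add: code_add code_sum code_cmult)
    qed
    then have "?B i j = 0"
      using K(2) ij unfolding determining_def by blast
    then show ?thesis by simp
  qed
  ultimately show ?thesis
    using that K(1) D by blast
qed

text \<open>The coefficients of \<open>m\<close> matrices over the dual basis \<open>D\<close> are
  \<open>m * card K\<close> unknowns. The product of the determinants of all nonempty sums is
  nonzero at the family \<open>B\<close>, hence also at some sparse point \<open>T\<close>.\<close>

lemma sparse_family_of_invertible_matrices:
  assumes "4 ^ m \<le> n"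
  obtains S A b where "S \<subseteq> P" "n * n \<le> card S + 2 ^ m * n"
    "\<And>E. E \<subseteq> {..<m} \<Longrightarrow> E \<noteq> {} \<Longrightarrow> det (mat n n (\<lambda>(i, j). A E i j)) \<noteq> 0"
    "\<And>E g. E \<subseteq> {..<m} \<Longrightarrow> code (A E) g = (\<Sum>i\<in>E. b g i)"
    "\<And>E g. E \<subseteq> {..<m} \<Longrightarrow> g \<in> S \<Longrightarrow> code (A E) g = 0"
proof -
  obtain K D where K: "K \<subseteq> P" "n * n \<le> card K"
    and D: "\<And>k g. k \<in> K \<Longrightarrow> g \<in> K \<Longrightarrow> code (D k) g = (if g = k then 1 else 0)"
    and expand: "\<And>A i j. i < n \<Longrightarrow> j < n \<Longrightarrow> A i j = (\<Sum>k\<in>K. code A k * D k i j)"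
    using information_set by blast
  have finK: "finite K"
    using K(1) finite_P by (rule finite_subset)
  from exists_linear_space_of_invertible_matrices[OF assms]
  obtain B :: "nat \<Rightarrow> nat \<Rightarrow> nat \<Rightarrow> bit" where B: "\<forall>E. E \<subseteq> {..<m} \<longrightarrow> E \<noteq> {} \<longrightarrow>
      det (mat n n (\<lambda>(i, j). \<Sum>e\<in>E. B e i j)) \<noteq> 0" ..
  define Es where "Es = Pow {..<m} - {{}}"
  define U where "U = {..<m} \<times> K"
  \<comment> \<open>\<open>u = (e, k)\<close> is the unknown coefficient of \<open>D k\<close> in
    the \<open>e\<close>-th matrix; \<open>a E i j u\<close> is its factor in entry (i, j) of the
    sum over \<open>E\<close>.\<close>
  define a where "a E i j u = (if fst u \<in> E then D (snd u) i j else 0)" for E i j and u :: "nat \<times> 'g"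
  define f where "f T = (\<Prod>E\<in>Es. det (mat n n (\<lambda>(i, j). \<Sum>u\<in>T. a E i j u)))" for T
  \<comment> \<open>The coordinates of the matrices \<open>B e\<close>.\<close>
  define T0 where "T0 = {u \<in> U. code (B (fst u)) (snd u) = 1}"
  have finEs: "finite Es" and finU: "finite U"
    using finK by (simp_all add: Es_def U_def)
  have "(\<Sum>u\<in>T0. a E i j u) = (\<Sum>e\<in>E. B e i j)" if "E \<in> Es" "i < n" "j < n" for E i j
  proof -
    have E: "E \<subseteq> {..<m}"
      using that(1) by (simp add: Es_def)
    have "(\<Sum>u\<in>T0. a E i j u) = (\<Sum>u\<in>U. if code (B (fst u)) (snd u) = 1 then a E i j u else 0)"
      unfolding T0_def by (simp only: sum.inter_filter[OF finU])
    also have "\<dots> = (\<Sum>u\<in>U. code (B (fst u)) (snd u) * a E i j u)"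
      by (intro sum.cong refl) auto
    also have "\<dots> = (\<Sum>e<m. \<Sum>k\<in>K. code (B e) k * a E i j (e, k))"
      unfolding U_def by (simp add: sum.cartesian_product case_prod_unfold)
    also have "\<dots> = (\<Sum>e<m. if e \<in> E then B e i j else 0)"
      using expand[OF that(2,3)] by (intro sum.cong refl) (simp add: a_def)
    also have "\<dots> = (\<Sum>e\<in>E. B e i j)"
      using E by (simp add: sum.inter_restrict[symmetric] Int_absorb1)
    finally show ?thesis .
  qed
  then have "mat n n (\<lambda>(i, j). \<Sum>u\<in>T0. a E i j u) = mat n n (\<lambda>(i, j). \<Sum>e\<in>E. B e i j)"
    if "E \<in> Es" for E
    using that by (intro cong_mat) auto
  then have f_T0: "f T0 \<noteq> 0"
    unfolding f_def using finEs B by (subst prod_zero_iff) (auto simp: Es_def)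
  have T0: "T0 \<subseteq> U"
    by (auto simp: T0_def)
  have f: "f T = (\<Sum>\<pi>\<in>Es \<rightarrow>\<^sub>E {p. p permutes {0..<n}}. \<Prod>d\<in>Es \<times> {0..<n}.
      \<Sum>u\<in>T. a (fst d) (snd d) (\<pi> (fst d) (snd d)) u)" for T
    unfolding f_def by (rule prod_det_as_sum_of_products[OF finEs])
  have "finite (Es \<times> {0..<n})"
    using finEs by simp
  then obtain T where T: "T \<subseteq> U" "f T \<noteq> 0" "card T \<le> card (Es \<times> {0..<n})"
    by (rule sparse_nonzero_point[OF finU _ f T0 f_T0])
  have finT: "finite T"
    using T(1) finU by (rule finite_subset)
  \<comment> \<open>Each unknown in \<open>T\<close> spoils at most one gate of
    \<open>K\<close>.\<close>
  define S where "S = K - snd ` T"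
  define A where "A E i j = (\<Sum>u\<in>T. a E i j u)" for E i j
  \<comment> \<open>The value at gate \<open>g\<close> of the codeword of the \<open>i\<close>-th
    matrix.\<close>
  define b where "b g i = (\<Sum>u\<in>T. if i = fst u then code (D (snd u)) g else 0)" for g i
  have code_A: "code (A E) g = (\<Sum>u\<in>T. if fst u \<in> E then code (D (snd u)) g else 0)" for E g
    unfolding A_def[abs_def] a_def by (simp only: code_sum code_if)
  show ?thesis
  proof
    show "S \<subseteq> P"
      using K(1) by (auto simp: S_def)
    have "card Es \<le> 2 ^ m"
      by (simp add: Es_def card_Pow)
    then have "card (Es \<times> {0..<n}) \<le> 2 ^ m * n"
      by (simp add: card_cartesian_product)
    with T(3) have "card T \<le> 2 ^ m * n"
      by (rule order.trans)
    moreover have "card (snd ` T) \<le> card T"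
      using finT by (rule card_image_le)
    moreover have "card K - card (snd ` T) \<le> card S"
      unfolding S_def using finT by (intro diff_card_le_card_Diff) simp
    ultimately show "n * n \<le> card S + 2 ^ m * n"
      using K(2) by linarith
  next
    fix E assume "E \<subseteq> {..<m}" "E \<noteq> {}"
    then have "E \<in> Es"
      by (simp add: Es_def)
    then show "det (mat n n (\<lambda>(i, j). A E i j)) \<noteq> 0"
      using T(2) finEs unfolding f_def A_def by (auto simp: prod_zero_iff)
  next
    fix E g assume "E \<subseteq> {..<m}"
    then have "finite E"
      by (rule finite_subset) simp
    have "(\<Sum>i\<in>E. b g i) = (\<Sum>u\<in>T. \<Sum>i\<in>E. if i = fst u then code (D (snd u)) g else 0)"
      unfolding b_def by (rule sum.swap)
    then show "code (A E) g = (\<Sum>i\<in>E. b g i)"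
      using \<open>finite E\<close> by (simp add: code_A)
  next
    fix E g assume "g \<in> S"
    show "code (A E) g = 0"
      unfolding code_A
    proof (intro sum.neutral ballI)
      fix u assume "u \<in> T"
      then have "snd u \<in> K" "g \<in> K" "g \<noteq> snd u"
        using \<open>g \<in> S\<close> T(1) by (auto simp: S_def U_def)
      then show "(if fst u \<in> E then code (D (snd u)) g else 0) = 0"
        by (simp add: D)
    qed
  qed
qed

text \<open>\<open>S\<close> has at least n^2 - 2^m * n gates. On the other gates, the 2^m - 1
  codewords for nonempty \<open>E\<close>, each of weight at least n^2, are averaged. The sum of
  both bounds is multiplied by 2^m to stay in the natural numbers.\<close>

lemma card_gates_bound:
  assumes "4 ^ m \<le> n"
  shows "3 * 2 ^ m * n ^ 2 \<le> 2 ^ m * card P + 4 ^ m * n + 2 * n ^ 2"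
proof -
  obtain S A b where S: "S \<subseteq> P" "n * n \<le> card S + 2 ^ m * n"
    and det: "\<And>E. E \<subseteq> {..<m} \<Longrightarrow> E \<noteq> {} \<Longrightarrow> det (mat n n (\<lambda>(i, j). A E i j)) \<noteq> 0"
    and code_A: "\<And>E g. E \<subseteq> {..<m} \<Longrightarrow> code (A E) g = (\<Sum>i\<in>E. b g i)"
    and zero: "\<And>E g. E \<subseteq> {..<m} \<Longrightarrow> g \<in> S \<Longrightarrow> code (A E) g = 0"
    using sparse_family_of_invertible_matrices[OF assms] by blast
  define wt where "wt E = card {g \<in> P - S. (\<Sum>i\<in>E. b g i) = 1}" for E
  have "n * n \<le> wt E" if "E \<in> Pow {..<m} - {{}}" for E
  proof -
    have E: "E \<subseteq> {..<m}" "E \<noteq> {}"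
      using that by auto
    have "{g \<in> P. code (A E) g = 1} = {g \<in> P - S. (\<Sum>i\<in>E. b g i) = 1}"
      using zero[OF E(1)] code_A[OF E(1)] by force
    then show ?thesis
      using weight_code_ge[OF det[OF E]] by (simp add: wt_def)
  qed
  then have "card (Pow {..<m} - {{}}) * (n * n) \<le> (\<Sum>E\<in>Pow {..<m} - {{}}. wt E)"
    using sum_bounded_below[of "Pow {..<m} - {{}}" "n * n" wt] by simp
  also have "\<dots> \<le> (\<Sum>E\<in>Pow {..<m}. wt E)"
    by (intro sum_mono2) auto
  also have "2 * \<dots> \<le> card (P - S) * 2 ^ m"
    using sum_weights_le[of "P - S" "{..<m}" b] finite_P by (simp add: wt_def)
  finally have "2 * ((2 ^ m - 1) * (n * n)) \<le> card (P - S) * 2 ^ m"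
    by (simp add: card_Pow)
  moreover have "card (P - S) = card P - card S" "card S \<le> card P"
    using S(1) finite_P by (auto simp: card_Diff_subset finite_subset card_mono)
  then have "card P = card (P - S) + card S"
    by simp
  moreover have "(2::nat) ^ m * (n * n) = (2 ^ m - 1) * (n * n) + n * n"
    by (cases "(2::nat) ^ m") auto
  moreover have "2 ^ m * (n * n) \<le> 2 ^ m * card S + 2 ^ m * 2 ^ m * n"
    using mult_le_mono2[OF S(2), of "2 ^ m"] by (simp add: algebra_simps)
  moreover have "(2::nat) ^ m * 2 ^ m = 4 ^ m"
    by (simp flip: power_mult_distrib)
  ultimately show ?thesis
    by (simp add: power2_eq_square algebra_simps)
qed

end

section \<open>Evaluation of circuits\<close>

definition ev_monom :: "('x \<Rightarrow> 'f::field) \<Rightarrow> ('x \<Rightarrow>\<^sub>0 nat) \<Rightarrow> 'f" where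
  "ev_monom \<sigma> m = (\<Prod>x\<in>Poly_Mapping.keys m. \<sigma> x ^ Poly_Mapping.lookup m x)"

text \<open>Over GF(2), evaluation identifies x^2 with x. This is harmless: polynomial identities
  are only ever turned into identities of values.\<close>

definition ev :: "('x \<Rightarrow> 'f::field) \<Rightarrow> ('x, 'f) mpoly \<Rightarrow> 'f" where
  "ev \<sigma> p = (\<Sum>m\<in>Poly_Mapping.keys p. Poly_Mapping.lookup p m * ev_monom \<sigma> m)"

lemma ev_monom_superset:
  assumes "finite S" "Poly_Mapping.keys m \<subseteq> S"
  shows "ev_monom \<sigma> m = (\<Prod>x\<in>S. \<sigma> x ^ Poly_Mapping.lookup m x)"
  unfolding ev_monom_def using assms
  by (intro prod.mono_neutral_left) (auto simp: in_keys_iff)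

lemma ev_monom_add: "ev_monom \<sigma> (m + m') = ev_monom \<sigma> m * ev_monom \<sigma> m'"
proof -
  let ?S = "Poly_Mapping.keys m \<union> Poly_Mapping.keys m'"
  have "ev_monom \<sigma> (m + m') = (\<Prod>x\<in>?S. \<sigma> x ^ Poly_Mapping.lookup (m + m') x)"
    by (intro ev_monom_superset) (auto simp: in_keys_iff lookup_add)
  also have "\<dots> = (\<Prod>x\<in>?S. \<sigma> x ^ Poly_Mapping.lookup m x) * (\<Prod>x\<in>?S. \<sigma> x ^ Poly_Mapping.lookup m' x)"
    by (simp add: lookup_add power_add prod.distrib)
  also have "\<dots> = ev_monom \<sigma> m * ev_monom \<sigma> m'"
    by (simp flip: ev_monom_superset)
  finally show ?thesis .
qed

lemma ev_0 [simp]: "ev \<sigma> 0 = 0"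
  by (simp add: ev_def)

lemma ev_single: "ev \<sigma> (Poly_Mapping.single m c) = c * ev_monom \<sigma> m"
  by (simp add: ev_def)

lemma ev_add: "ev \<sigma> (p + q) = ev \<sigma> p + ev \<sigma> q"
  unfolding ev_def
  by (intro setsum_keys_plus_distrib) (simp_all add: algebra_simps)

lemma ev_sum: "ev \<sigma> (\<Sum>x\<in>S. f x) = (\<Sum>x\<in>S. ev \<sigma> (f x))"
  by (induction S rule: infinite_finite_induct) (simp_all add: ev_add)

lemma poly_mapping_eq_sum_single:
  "(p :: 'a \<Rightarrow>\<^sub>0 'b::comm_monoid_add) =
    (\<Sum>m\<in>Poly_Mapping.keys p. Poly_Mapping.single m (Poly_Mapping.lookup p m))"
proof (rule poly_mapping_eqI)
  fix k
  have "Poly_Mapping.lookup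
      (\<Sum>m\<in>Poly_Mapping.keys p. Poly_Mapping.single m (Poly_Mapping.lookup p m)) k =
      (\<Sum>m\<in>Poly_Mapping.keys p. if m = k then Poly_Mapping.lookup p m else 0)"
    by (auto simp: lookup_sum lookup_single when_def intro: sum.cong)
  then show "Poly_Mapping.lookup p k = Poly_Mapping.lookup
      (\<Sum>m\<in>Poly_Mapping.keys p. Poly_Mapping.single m (Poly_Mapping.lookup p m)) k"
    by (simp add: in_keys_iff)
qed

lemma ev_mult: "ev \<sigma> (p * q) = ev \<sigma> p * ev \<sigma> q"
proof -
  let ?s = "\<lambda>p m. Poly_Mapping.single m (Poly_Mapping.lookup p m)"
  have "p * q = (\<Sum>m\<in>Poly_Mapping.keys p. ?s p m) * (\<Sum>m\<in>Poly_Mapping.keys q. ?s q m)"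
    by (simp flip: poly_mapping_eq_sum_single)
  also have "ev \<sigma> \<dots> = (\<Sum>m\<in>Poly_Mapping.keys p. ev \<sigma> (?s p m)) * (\<Sum>m\<in>Poly_Mapping.keys q. ev \<sigma> (?s q m))"
    by (simp add: sum_product ev_sum mult_single ev_single ev_monom_add ac_simps)
  also have "\<dots> = ev \<sigma> p * ev \<sigma> q"
    by (simp flip: ev_sum poly_mapping_eq_sum_single)
  finally show ?thesis .
qed

lemma ev_Const [simp]: "ev \<sigma> (Const c) = c"
  by (simp add: Const_def ev_single ev_monom_def)

lemma ev_Var [simp]: "ev \<sigma> (Var x) = \<sigma> x"
  by (simp add: Var_def ev_single ev_monom_def)

lemma additive_form_ev_linear_form:
  assumes "linear_form V (p :: ('x, bit) mpoly)"
  shows "additive_form (\<lambda>\<sigma>. ev \<sigma> p)"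
proof -
  obtain S c where "p = (\<Sum>x\<in>S. Const (c x) * Var x)"
    using assms by (auto simp: linear_form_def)
  then show ?thesis
    by (simp add: additive_form_def ev_sum ev_mult algebra_simps sum.distrib)
qed

lemma ev_prod_gate:
  fixes C :: "('v, 'a, 'x, bit) circuit"
  assumes C: "quadratic_circuit V C" and v: "v \<in> verts (graph C)" "node C v = Prod_Gate"
  obtains l r where "additive_form l" "additive_form r" "\<And>\<sigma>. ev \<sigma> (node_poly C v) = l \<sigma> * r \<sigma>"
proof -
  let ?w = "\<lambda>e. Const (weight C e) * node_poly C (tail (graph C) e)"
  have dag: "circuit_dag C" and deg: "card (in_arcs (graph C) v) = 2"
    and lin: "\<And>e. e \<in> in_arcs (graph C) v \<Longrightarrow> linear_form V (?w e)"
    using C v by (auto simp: quadratic_circuit_def arith_circuit_def in_degree_def)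
  \<comment> \<open>The arcs are distinct but may share their tail, so squares are covered.\<close>
  from deg obtain e e' where e: "in_arcs (graph C) v = {e, e'}" "e \<noteq> e'"
    by (auto simp: card_2_iff)
  have "node_poly C v = ?w e * ?w e'"
    using dag v e by (subst node_poly.simps) simp
  then have "ev \<sigma> (node_poly C v) = ev \<sigma> (?w e) * ev \<sigma> (?w e')" for \<sigma>
    by (simp only: ev_mult)
  moreover have "additive_form (\<lambda>\<sigma>. ev \<sigma> (?w e))" "additive_form (\<lambda>\<sigma>. ev \<sigma> (?w e'))"
    using lin e by (auto intro: additive_form_ev_linear_form)
  ultimately show ?thesis
    using that by blast
qed

text \<open>Inputs are additive and sum gates combine what they receive. A product gate is itself
  one of the spanning elements, so its predecessors are not expanded.\<close>

lemma ev_node_poly_in_span_of_prod_gates: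
  fixes C :: "('v, 'a, 'x, bit) circuit"
  assumes "circuit_dag C" "v \<in> verts (graph C)"
  shows "\<exists>L c. additive_form L \<and> (\<forall>\<sigma>. ev \<sigma> (node_poly C v) =
    L \<sigma> + (\<Sum>g\<in>{g \<in> verts (graph C). node C g = Prod_Gate}. c g * ev \<sigma> (node_poly C g)))"
  using assms
proof (induction C v rule: node_poly.induct)
  case (1 C v)
  let ?P = "{g \<in> verts (graph C). node C g = Prod_Gate}"
  interpret fin_digraph "graph C"
    using 1(3) by (simp add: circuit_dag_def)
  show ?case
  proof (cases "node C v")
    case (Input x)
    then have "ev \<sigma> (node_poly C v) = \<sigma> x + (\<Sum>g\<in>?P. 0 * ev \<sigma> (node_poly C g))" for \<sigma>
      using 1(3,4) by (subst node_poly.simps) simp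
    moreover have "additive_form (\<lambda>\<sigma>. \<sigma> x)"
      by (simp add: additive_form_def)
    ultimately show ?thesis
      by (intro exI[of _ "\<lambda>\<sigma>. \<sigma> x"] exI[of _ "\<lambda>_. 0"]) simp
  next
    case Sum_Gate
    have "\<forall>e\<in>in_arcs (graph C) v. \<exists>L c. additive_form L \<and>
        (\<forall>\<sigma>. ev \<sigma> (node_poly C (tail (graph C) e)) =
          L \<sigma> + (\<Sum>g\<in>?P. c g * ev \<sigma> (node_poly C g)))"
      using 1(1) 1(3,4) Sum_Gate by auto
    from bchoice[OF this] obtain L where "\<forall>e\<in>in_arcs (graph C) v. \<exists>c. additive_form (L e) \<and>
        (\<forall>\<sigma>. ev \<sigma> (node_poly C (tail (graph C) e)) =
          L e \<sigma> + (\<Sum>g\<in>?P. c g * ev \<sigma> (node_poly C g)))" ..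
    from bchoice[OF this] obtain c where Lc: "\<forall>e\<in>in_arcs (graph C) v. additive_form (L e) \<and>
        (\<forall>\<sigma>. ev \<sigma> (node_poly C (tail (graph C) e)) =
          L e \<sigma> + (\<Sum>g\<in>?P. c e g * ev \<sigma> (node_poly C g)))" ..
    then have c: "ev \<sigma> (node_poly C (tail (graph C) e)) =
          L e \<sigma> + (\<Sum>g\<in>?P. c e g * ev \<sigma> (node_poly C g))" if "e \<in> in_arcs (graph C) v" for e \<sigma>
      using that by blast
    let ?L = "\<lambda>\<sigma>. \<Sum>e\<in>in_arcs (graph C) v. weight C e * L e \<sigma>"
    let ?c = "\<lambda>g. \<Sum>e\<in>in_arcs (graph C) v. weight C e * c e g"
    have "additive_form ?L"
      using Lc by (simp add: additive_form_def distrib_left sum.distrib)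
    moreover have "ev \<sigma> (node_poly C v) = ?L \<sigma> + (\<Sum>g\<in>?P. ?c g * ev \<sigma> (node_poly C g))" for \<sigma>
    proof -
      have "ev \<sigma> (node_poly C v) =
          (\<Sum>e\<in>in_arcs (graph C) v. weight C e * ev \<sigma> (node_poly C (tail (graph C) e)))"
        using 1(3,4) Sum_Gate by (subst node_poly.simps) (simp add: ev_sum ev_mult)
      also have "\<dots> = ?L \<sigma> + (\<Sum>e\<in>in_arcs (graph C) v. \<Sum>g\<in>?P.
          weight C e * c e g * ev \<sigma> (node_poly C g))"
        by (simp add: c distrib_left sum.distrib sum_distrib_left mult.assoc)
      also have "(\<Sum>e\<in>in_arcs (graph C) v. \<Sum>g\<in>?P. weight C e * c e g * ev \<sigma> (node_poly C g)) =
          (\<Sum>g\<in>?P. ?c g * ev \<sigma> (node_poly C g))"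
        unfolding sum_distrib_right by (rule sum.swap)
      finally show ?thesis .
    qed
    ultimately show ?thesis
      by (intro exI[of _ ?L] exI[of _ ?c]) simp
  next
    case Prod_Gate
    then have "ev \<sigma> (node_poly C v) =
        0 + (\<Sum>g\<in>?P. (if g = v then 1 else 0) * ev \<sigma> (node_poly C g))" for \<sigma>
      using 1(4) by (simp add: if_distrib[of "\<lambda>x. x * _"] cong: if_cong)
    moreover have "additive_form (\<lambda>_. 0)"
      by (simp add: additive_form_def)
    ultimately show ?thesis
      by (intro exI[of _ "\<lambda>_. 0"] exI[of _ "\<lambda>g. if g = v then 1 else 0"]) simp
  qed
qed

lemma num_prod_gates_bound:
  fixes C :: "('v, 'a, mat_var, bit) circuit"
  assumes C: "quadratic_circuit (mat_vars n) C" "computes_mat_prod n C" and "4 ^ m \<le> n"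
  shows "3 * 2 ^ m * n ^ 2 \<le> 2 ^ m * num_prod_gates C + 4 ^ m * n + 2 * n ^ 2"
proof -
  define P where "P = {g \<in> verts (graph C). node C g = Prod_Gate}"
  have dag: "circuit_dag C"
    using C(1) by (simp add: quadratic_circuit_def arith_circuit_def)
  then interpret fin_digraph "graph C"
    by (simp add: circuit_dag_def)
  have "\<exists>l r. additive_form l \<and> additive_form r \<and> (\<forall>\<sigma>. ev \<sigma> (node_poly C g) = l \<sigma> * r \<sigma>)"
    if "g \<in> P" for g
    using that ev_prod_gate[OF C(1), of g] unfolding P_def by blast
  then obtain l r where lr: "\<And>g. g \<in> P \<Longrightarrow> additive_form (l g)" "\<And>g. g \<in> P \<Longrightarrow> additive_form (r g)"
      "\<And>g \<sigma>. g \<in> P \<Longrightarrow> ev \<sigma> (node_poly C g) = l g \<sigma> * r g \<sigma>"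
    by metis
  let ?q = "\<lambda>ij \<sigma>. \<Sum>k<n. \<sigma> (X (Suc (fst ij)) (Suc k)) * \<sigma> (Y (Suc k) (Suc (snd ij)))"
  have "\<forall>ij\<in>{..<n} \<times> {..<n}. \<exists>L c. additive_form L \<and>
      (\<forall>\<sigma>. ?q ij \<sigma> = L \<sigma> + (\<Sum>g\<in>P. c g * (l g \<sigma> * r g \<sigma>)))"
  proof
    fix ij assume "ij \<in> {..<n} \<times> {..<n}"
    moreover obtain i j where ij_eq: "ij = (i, j)"
      by fastforce
    ultimately have ij: "i < n" "j < n"
      by auto
    have "\<exists>v\<in>verts (graph C). node_poly C v = mat_prod_entry n (Suc i) (Suc j)"
      using C(2) ij by (simp add: computes_mat_prod_def)
    then obtain v where v: "v \<in> verts (graph C)" "node_poly C v = mat_prod_entry n (Suc i) (Suc j)"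
      by blast
    have "ev \<sigma> (node_poly C v) = (\<Sum>k<n. \<sigma> (X (Suc i) (Suc k)) * \<sigma> (Y (Suc k) (Suc j)))" for \<sigma>
      unfolding v(2) mat_prod_entry_def ev_sum ev_mult ev_Var
      by (simp only: sum.atLeast1_atMost_eq One_nat_def)
    moreover obtain L c where "additive_form L"
        "\<forall>\<sigma>. ev \<sigma> (node_poly C v) = L \<sigma> + (\<Sum>g\<in>P. c g * ev \<sigma> (node_poly C g))"
      using ev_node_poly_in_span_of_prod_gates[OF dag v(1)] unfolding P_def by blast
    ultimately show "\<exists>L c. additive_form L \<and>
        (\<forall>\<sigma>. ?q ij \<sigma> = L \<sigma> + (\<Sum>g\<in>P. c g * (l g \<sigma> * r g \<sigma>)))"
      by (intro exI[of _ L] exI[of _ c]) (simp add: ij_eq lr(3))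
  qed
  from bchoice[OF this] obtain L where "\<forall>ij\<in>{..<n} \<times> {..<n}. \<exists>c. additive_form (L ij) \<and>
      (\<forall>\<sigma>. ?q ij \<sigma> = L ij \<sigma> + (\<Sum>g\<in>P. c g * (l g \<sigma> * r g \<sigma>)))" ..
  from bchoice[OF this] obtain \<gamma> where L\<gamma>: "\<forall>ij\<in>{..<n} \<times> {..<n}. additive_form (L ij) \<and>
      (\<forall>\<sigma>. ?q ij \<sigma> = L ij \<sigma> + (\<Sum>g\<in>P. \<gamma> ij g * (l g \<sigma> * r g \<sigma>)))" ..
  interpret quadratic_mat_prod n P l r "\<lambda>i j. \<gamma> (i, j)" "\<lambda>i j. L (i, j)"
  proof
    show "finite P"
      by (simp add: P_def)
    fix i j :: nat and \<sigma> :: "mat_var \<Rightarrow> bit"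
    assume ij: "i < n" "j < n"
    then show "additive_form (L (i, j))"
      using L\<gamma> by simp
    show "(\<Sum>k<n. \<sigma> (X (Suc i) (Suc k)) * \<sigma> (Y (Suc k) (Suc j))) =
        L (i, j) \<sigma> + (\<Sum>g\<in>P. \<gamma> (i, j) g * (l g \<sigma> * r g \<sigma>))"
      using bspec[OF L\<gamma>, of "(i, j)"] ij by simp
  qed (rule lr; assumption)+
  show ?thesis
    using card_gates_bound[OF \<open>4 ^ m \<le> n\<close>] by (simp add: num_prod_gates_def P_def)
qed

section \<open>Choice of \<open>m\<close> and the final estimate\<close>

lemma exists_power_4_between:
  assumes "n \<ge> (1::nat)"
  obtains m where "4 ^ m \<le> n" "n < 4 * 4 ^ m"
proof -
  obtain m where "4 ^ m \<le> n" "n < 4 ^ (m + 1)"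
    using ex_power_ivl1[of 4 n] assms by auto
  then show ?thesis
    using that by simp
qed

theorem theorem2:
  shows "\<exists>K::real. \<forall>n\<ge>1. \<forall>C :: (nat, nat, mat_var, bit) circuit.
    quadratic_circuit (mat_vars n) C \<and> computes_mat_prod n C \<longrightarrow>
      real (num_prod_gates C) \<ge> 3 * real n ^ 2 - K * real n powr (5 / 3)"
proof (intro exI[of _ 5] allI impI)
  fix n :: nat and C :: "(nat, nat, mat_var, bit) circuit"
  assume n: "n \<ge> 1" and C: "quadratic_circuit (mat_vars n) C \<and> computes_mat_prod n C"
  obtain m where m: "4 ^ m \<le> n" "n < 4 * 4 ^ m"
    using exists_power_4_between[OF n] .
  \<comment> \<open>By the choice of \<open>m\<close>, s/2 <= a <= s. After division by
    \<open>a\<close>, the error terms are a n <= s^3 and 2 n^2 / a <= 4 s^3; their sum 5 s^3 = 5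
    n^(3/2) explains the constant 5.\<close>
  define a where "a = (2::real) ^ m"
  define s where "s = sqrt (real n)"
  define t where "t = real (num_prod_gates C)"
  have a_pos: "a > 0" and s_pos: "s > 0" and n_eq: "real n = s * s"
    using n by (simp_all add: a_def s_def)
  have a_sq: "a * a = real (4 ^ m)"
    by (simp add: a_def flip: power_mult_distrib)
  have "a * a \<le> s * s"
    unfolding a_sq n_eq[symmetric] using m(1) by (simp only: of_nat_le_iff)
  then have a_le: "a \<le> s"
    using s_pos by (intro power2_le_imp_le[of a s]) (simp_all add: power2_eq_square)
  have "real n \<le> real (4 * 4 ^ m)"
    using m(2) by (simp only: of_nat_le_iff)
  then have "s * s \<le> (2 * a) * (2 * a)"
    using a_sq by (simp add: n_eq)
  then have s_le: "s \<le> 2 * a"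
    using a_pos by (intro power2_le_imp_le[of s "2 * a"]) (simp_all add: power2_eq_square)
  have "3 * 2 ^ m * n ^ 2 \<le> 2 ^ m * num_prod_gates C + 4 ^ m * n + 2 * n ^ 2"
    using num_prod_gates_bound C m(1) by blast
  then have "real (3 * 2 ^ m * n ^ 2) \<le> real (2 ^ m * num_prod_gates C + 4 ^ m * n + 2 * n ^ 2)"
    by (simp only: of_nat_le_iff)
  then have "a * (3 * real n ^ 2) \<le> a * t + a * a * real n + 2 * real n ^ 2"
    using a_sq by (simp add: a_def t_def mult.assoc mult.left_commute)
  also have "2 * real n ^ 2 = s * (2 * s ^ 3)"
    by (simp add: n_eq power2_eq_square power3_eq_cube algebra_simps)
  also have "\<dots> \<le> (2 * a) * (2 * s ^ 3)"
    using s_le s_pos by (intro mult_right_mono) auto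
  finally have "a * (3 * real n ^ 2) \<le> a * (t + a * real n + 4 * s ^ 3)"
    by (simp add: algebra_simps)
  then have "3 * real n ^ 2 \<le> t + a * real n + 4 * s ^ 3"
    using a_pos by simp
  also have "a * real n \<le> s ^ 3"
    using a_le s_pos by (simp add: n_eq power3_eq_cube mult_right_mono)
  finally have "3 * real n ^ 2 \<le> t + 5 * s ^ 3"
    by simp
  also have "s ^ 3 = real n powr (3 / 2)"
    using n by (simp add: s_def powr_half_sqrt[symmetric] powr_powr flip: powr_realpow)
  also have "\<dots> \<le> real n powr (5 / 3)"
    using n by (intro powr_mono) auto
  finally show "real (num_prod_gates C) \<ge> 3 * real n ^ 2 - 5 * real n powr (5 / 3)"
    by (simp add: t_def)
qed

end
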